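(* Let $G$ be a simple strongly connected digraph with $n\ge 4$ vertices and $m$ arcs. If $\alpha\in[\frac{1}{2},1)$, then $$\lambda_\alpha(G)\le \max\left\{\alpha\Delta^+(G),\,(1-\alpha)\frac{m-n+1}{2}\right\}+2\alpha.$$
   Context: A digraph is simple if it has no loops and no multiple arcs; it is strongly connected if for every ordered pair of vertices $v_i,v_j$ there is a directed path from $v_i$ to $v_j$. For a digraph $G$ with vertex set $\{v_1,\dots,v_n\}$, $d_i^+$ denotes the outdegree of $v_i$ (number of arcs with tail $v_i$) and $\Delta^+(G)$ the maximum outdegree. $A(G)$ is the adjacency matrix, $D(G)=\mathrm{diag}(d_1^+,\dots,d_n^+)$, and $A_\alpha(G)=\alpha D(G)+(1-\alpha)A(G)$. $\lambda_\alpha(G)$ is the eigenvalue of $A_\alpha(G)$ of largest modulus. *)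

theory Defs
  imports "Graph_Theory.Digraph_Component" "Jordan_Normal_Form.Spectral_Radius"
begin

text \<open>
  The matrices of a digraph are taken with respect to an enumeration \<open>v 0, \<dots>, v (n - 1)\<close>
  of its \<open>n\<close> vertices.
\<close>

definition max_out_degree :: "('a, 'b) pre_digraph \<Rightarrow> nat" where
  "max_out_degree G = Max (out_degree G ` verts G)"

definition adjacency_mat :: "('a, 'b) pre_digraph \<Rightarrow> (nat \<Rightarrow> 'a) \<Rightarrow> real mat" where
  "adjacency_mat G v = mat (card (verts G)) (card (verts G))
     (\<lambda>(i, j). if v i \<rightarrow>\<^bsub>G\<^esub> v j then 1 else 0)"

definition out_degree_mat :: "('a, 'b) pre_digraph \<Rightarrow> (nat \<Rightarrow> 'a) \<Rightarrow> real mat" where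
  "out_degree_mat G v = mat (card (verts G)) (card (verts G))
     (\<lambda>(i, j). if i = j then real (out_degree G (v i)) else 0)"

definition A_alpha_mat :: "real \<Rightarrow> ('a, 'b) pre_digraph \<Rightarrow> (nat \<Rightarrow> 'a) \<Rightarrow> real mat" where
  "A_alpha_mat \<alpha> G v = \<alpha> \<cdot>\<^sub>m out_degree_mat G v + (1 - \<alpha>) \<cdot>\<^sub>m adjacency_mat G v"

text \<open>
  The modulus is maximised over all complex eigenvalues. For a strongly connected simple
  digraph with at least two vertices and \<open>0 < \<alpha> < 1\<close>, the matrix is primitive, so by
  Perron-Frobenius exactly one complex eigenvalue has largest modulus, and it is real.
\<close>

definition lambda_alpha :: "real \<Rightarrow> ('a, 'b) pre_digraph \<Rightarrow> (nat \<Rightarrow> 'a) \<Rightarrow> real" where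
  "lambda_alpha \<alpha> G v = (THE r.
     complex_of_real r \<in> spectrum (map_mat complex_of_real (A_alpha_mat \<alpha> G v)) \<and>
     (\<forall>\<mu> \<in> spectrum (map_mat complex_of_real (A_alpha_mat \<alpha> G v)).
        cmod \<mu> \<le> cmod (complex_of_real r)))"

end

theory Submission
  imports Defs
begin

text \<open>
  The vector of outdegrees is positive, and the \<open>i\<close>-th entry of its image under \<open>A\<^sub>\<alpha>\<close> is
  \<open>\<alpha> d\<^sub>i\<^sup>2 + (1 - \<alpha>) t\<^sub>i\<close>, where \<open>t\<^sub>i\<close> is the sum of the outdegrees of the out-neighbours of \<open>v\<^sub>i\<close>.
  Hence the spectral radius is at most the maximum of \<open>\<alpha> d\<^sub>i + (1 - \<alpha>) t\<^sub>i / d\<^sub>i\<close>. All outdegrees being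
  at least 1, \<open>t\<^sub>i\<close> is bounded by \<open>m - n + 1\<close> as well as by \<open>d\<^sub>i \<Delta>\<^sup>+\<close>; the latter settles \<open>d\<^sub>i = 1\<close>, the
  former \<open>d\<^sub>i \<ge> 2\<close>. That \<open>\<lambda>\<^sub>\<alpha>\<close> is the spectral radius is the Perron-Frobenius theorem for irreducible
  matrices with positive diagonal.
\<close>

section \<open>Eigenvectors in coordinates and subinvariant vectors\<close>

text \<open>Eigenvectors become functions on indices, so that the later estimates are about finite
  sums.\<close>

lemma eigenvalue_iff_sum:
  fixes A :: "'a :: field mat"
  assumes A: "A \<in> carrier_mat n n"
  shows "eigenvalue A \<mu> \<longleftrightarrow>
    (\<exists>z. (\<exists>i<n. z i \<noteq> 0) \<and> (\<forall>i<n. (\<Sum>j<n. A $$ (i,j) * z j) = \<mu> * z i))"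
proof
  assume "eigenvalue A \<mu>"
  then obtain w where w: "w \<in> carrier_vec n" "w \<noteq> 0\<^sub>v n" "A *\<^sub>v w = \<mu> \<cdot>\<^sub>v w"
    using A unfolding eigenvalue_def eigenvector_def by auto
  have "\<exists>i<n. w $ i \<noteq> 0" using w(1,2) by (metis carrier_vecD eq_vecI index_zero_vec)
  moreover have "(\<Sum>j<n. A $$ (i,j) * w $ j) = \<mu> * w $ i" if "i < n" for i
  proof -
    have "(A *\<^sub>v w) $ i = \<mu> * w $ i" using w that by simp
    thus ?thesis using that A w(1) by (auto simp: scalar_prod_def lessThan_atLeast0)
  qed
  ultimately show "\<exists>z. (\<exists>i<n. z i \<noteq> 0) \<and> (\<forall>i<n. (\<Sum>j<n. A $$ (i,j) * z j) = \<mu> * z i)"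
    by (intro exI[of _ "\<lambda>i. w $ i"]) auto
next
  assume "\<exists>z. (\<exists>i<n. z i \<noteq> 0) \<and> (\<forall>i<n. (\<Sum>j<n. A $$ (i,j) * z j) = \<mu> * z i)"
  then obtain z where z: "\<exists>i<n. z i \<noteq> 0" "\<forall>i<n. (\<Sum>j<n. A $$ (i,j) * z j) = \<mu> * z i"
    by blast
  have "eigenvector A (vec n z) \<mu>" unfolding eigenvector_def
  proof (intro conjI)
    show "vec n z \<in> carrier_vec (dim_row A)" using A by auto
    show "vec n z \<noteq> 0\<^sub>v (dim_row A)" using z(1) A by (auto simp: vec_eq_iff)
    show "A *\<^sub>v vec n z = \<mu> \<cdot>\<^sub>v vec n z"
      by (rule eq_vecI) (use A z(2) in \<open>auto simp: scalar_prod_def lessThan_atLeast0\<close>)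
  qed
  thus "eigenvalue A \<mu>" unfolding eigenvalue_def by blast
qed

text \<open>Triangle inequality: \<open>y\<close> collects the moduli of the coordinates of an
  eigenvector, and nonnegative entries pass through the modulus unchanged.\<close>

lemma eigenvalue_modulus_subinvariant:
  fixes M :: "real mat"
  assumes M: "M \<in> carrier_mat n n"
    and nonneg: "\<And>i j. i < n \<Longrightarrow> j < n \<Longrightarrow> M $$ (i,j) \<ge> 0"
    and ev: "eigenvalue (map_mat complex_of_real M) \<mu>"
  obtains y :: "nat \<Rightarrow> real" where "\<And>i. y i \<ge> 0" "\<exists>i<n. y i > 0"
    "\<And>i. i < n \<Longrightarrow> cmod \<mu> * y i \<le> (\<Sum>j<n. M $$ (i,j) * y j)"
proof -
  have C: "map_mat complex_of_real M \<in> carrier_mat n n" using M by simp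
  obtain z where z: "\<exists>i<n. z i \<noteq> 0"
    "\<And>i. i < n \<Longrightarrow> (\<Sum>j<n. map_mat complex_of_real M $$ (i,j) * z j) = \<mu> * z i"
    using ev unfolding eigenvalue_iff_sum[OF C] by blast
  show thesis
  proof (rule that[of "\<lambda>i. cmod (z i)"])
    fix i assume i: "i < n"
    have "cmod \<mu> * cmod (z i) = cmod (\<Sum>j<n. map_mat complex_of_real M $$ (i,j) * z j)"
      using z(2)[OF i] by (simp add: norm_mult)
    also have "\<dots> \<le> (\<Sum>j<n. cmod (map_mat complex_of_real M $$ (i,j) * z j))" by (rule norm_sum)
    also have "\<dots> = (\<Sum>j<n. M $$ (i,j) * cmod (z j))"
      by (rule sum.cong) (use M i nonneg in \<open>auto simp: norm_mult\<close>)
    finally show "cmod \<mu> * cmod (z i) \<le> (\<Sum>j<n. M $$ (i,j) * cmod (z j))" .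
  qed (use z(1) in auto)
qed

text \<open>Induction on \<open>k\<close>. Nonnegativity of the entries of the power is carried
  along because the inequality for \<open>N\<close> gets multiplied by those entries.\<close>

lemma subinvariant_power:
  fixes N :: "real mat" and y :: "nat \<Rightarrow> real"
  assumes N: "N \<in> carrier_mat n n"
    and nonneg: "\<And>i j. i < n \<Longrightarrow> j < n \<Longrightarrow> N $$ (i,j) \<ge> 0"
    and q: "q \<ge> 0"
    and sub: "\<And>i. i < n \<Longrightarrow> q * y i \<le> (\<Sum>j<n. N $$ (i,j) * y j)"
  shows "(\<forall>i<n. \<forall>j<n. (N ^\<^sub>m k) $$ (i,j) \<ge> 0) \<and>
    (\<forall>i<n. q ^ k * y i \<le> (\<Sum>j<n. (N ^\<^sub>m k) $$ (i,j) * y j))"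
proof (induction k)
  case 0
  have "(\<Sum>j<n. (1\<^sub>m n :: real mat) $$ (i,j) * y j) = y i" if "i < n" for i
  proof -
    have "(\<Sum>j<n. (1\<^sub>m n :: real mat) $$ (i,j) * y j) = (\<Sum>j<n. if j = i then y j else 0)"
      by (rule sum.cong) (use that in auto)
    thus ?thesis using that by simp
  qed
  thus ?case using N by auto
next
  case (Suc k)
  have P: "N ^\<^sub>m k \<in> carrier_mat n n" using N by simp
  have entry: "(N ^\<^sub>m Suc k) $$ (i,j) = (\<Sum>l<n. (N ^\<^sub>m k) $$ (i,l) * N $$ (l,j))"
    if "i < n" "j < n" for i j
    using that N P by (auto simp: scalar_prod_def lessThan_atLeast0)
  have "q ^ Suc k * y i \<le> (\<Sum>j<n. (N ^\<^sub>m Suc k) $$ (i,j) * y j)" if i: "i < n" for i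
  proof -
    have "q ^ Suc k * y i \<le> q * (\<Sum>l<n. (N ^\<^sub>m k) $$ (i,l) * y l)"
      using Suc i q by (simp add: mult.assoc mult_left_mono)
    also have "\<dots> = (\<Sum>l<n. (N ^\<^sub>m k) $$ (i,l) * (q * y l))"
      by (simp add: sum_distrib_left mult.left_commute)
    also have "\<dots> \<le> (\<Sum>l<n. (N ^\<^sub>m k) $$ (i,l) * (\<Sum>j<n. N $$ (l,j) * y j))"
      by (intro sum_mono mult_left_mono sub) (use Suc i in auto)
    also have "\<dots> = (\<Sum>l<n. \<Sum>j<n. (N ^\<^sub>m k) $$ (i,l) * N $$ (l,j) * y j)"
      by (simp add: sum_distrib_left mult.assoc)
    also have "\<dots> = (\<Sum>j<n. \<Sum>l<n. (N ^\<^sub>m k) $$ (i,l) * N $$ (l,j) * y j)"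
      by (rule sum.swap)
    also have "\<dots> = (\<Sum>j<n. (N ^\<^sub>m Suc k) $$ (i,j) * y j)"
      by (rule sum.cong[OF refl]) (use entry[OF i] in \<open>simp add: sum_distrib_right del: pow_mat.simps\<close>)
    finally show ?thesis .
  qed
  moreover have "(N ^\<^sub>m Suc k) $$ (i,j) \<ge> 0" if "i < n" "j < n" for i j
    unfolding entry[OF that] by (intro sum_nonneg mult_nonneg_nonneg) (use Suc nonneg that in auto)
  ultimately show ?case by blast
qed

section \<open>Spectral radius bounds from subinvariant and superinvariant vectors\<close>

text \<open>
  If \<open>c\<close> exceeded the spectral radius, then for some \<open>t\<close> in between the powers of \<open>M / t\<close> would be
  bounded, although they expand \<open>y\<close> by the factor \<open>(c / t) ^ k\<close>.
\<close>

lemma spectral_radius_ge_subinvariant: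
  fixes M :: "real mat" and y :: "nat \<Rightarrow> real"
  assumes M: "M \<in> carrier_mat n n"
    and nonneg: "\<And>i j. i < n \<Longrightarrow> j < n \<Longrightarrow> M $$ (i,j) \<ge> 0"
    and y: "\<And>i. i < n \<Longrightarrow> y i \<ge> 0" and p: "p < n" "y p > 0"
    and sub: "\<And>i. i < n \<Longrightarrow> c * y i \<le> (\<Sum>j<n. M $$ (i,j) * y j)"
  shows "c \<le> spectral_radius (map_mat complex_of_real M)"
proof (rule ccontr)
  let ?C = "map_mat complex_of_real M"
  let ?s = "spectral_radius ?C"
  assume "\<not> ?thesis"
  then obtain t where t: "?s < t" "t < c" using dense[of ?s c] by (auto simp: not_le)
  have C: "?C \<in> carrier_mat n n" using M by simp
  have n: "n > 0" using p by auto
  have "?s \<ge> 0" using spectral_radius_mem_max(1)[OF C n] by auto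
  hence t0: "t > 0" using t by simp
  define N where "N = (1 / t) \<cdot>\<^sub>m M"
  let ?B = "map_mat complex_of_real N"
  have N: "N \<in> carrier_mat n n" and B: "?B \<in> carrier_mat n n" using M by (auto simp: N_def)
  have "spectral_radius ?B < 1"
  proof -
    obtain \<mu> where \<mu>: "eigenvalue ?B \<mu>" "spectral_radius ?B = cmod \<mu>"
      using spectral_radius_mem_max(1)[OF B n] by (auto simp: spectrum_def)
    then obtain z where z: "\<exists>i<n. z i \<noteq> 0"
      "\<And>i. i < n \<Longrightarrow> (\<Sum>j<n. ?B $$ (i,j) * z j) = \<mu> * z i"
      unfolding eigenvalue_iff_sum[OF B] by blast
    \<comment> \<open>Undoing the scaling makes \<open>t * \<mu>\<close> an eigenvalue of
      \<open>?C\<close>, so its modulus is at most \<open>?s\<close>, which is below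
      \<open>t\<close>.\<close>
    have "(\<Sum>j<n. ?C $$ (i,j) * z j) = t * \<mu> * z i" if i: "i < n" for i
    proof -
      have "(\<Sum>j<n. ?C $$ (i,j) * z j) = t * (\<Sum>j<n. ?B $$ (i,j) * z j)"
        unfolding sum_distrib_left
        by (rule sum.cong) (use i M t0 in \<open>auto simp: N_def\<close>)
      thus ?thesis using z(2)[OF i] by simp
    qed
    hence "eigenvalue ?C (t * \<mu>)" unfolding eigenvalue_iff_sum[OF C] using z(1) by blast
    hence "cmod (t * \<mu>) \<le> ?s" using spectral_radius_mem_max(2)[OF C n] by (auto simp: spectrum_def)
    hence "t * cmod \<mu> \<le> ?s" using t0 by (simp add: norm_mult)
    hence "t * cmod \<mu> < t" using t(1) by linarith
    thus ?thesis using t0 \<mu>(2) by simp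
  qed
  \<comment> \<open>Spectral radius below 1 bounds the entries of all powers by one constant
    \<open>b\<close>, independent of the exponent.\<close>
  from spectral_radius_jnf_norm_bound_less_1_upper_triangular[OF B this]
  obtain b where b: "\<And>k. norm_bound (?B ^\<^sub>m k) b" by blast
  have Nnn: "N $$ (i,j) \<ge> 0" if "i < n" "j < n" for i j
    using nonneg[OF that] t0 M that by (auto simp: N_def)
  have Nsub: "(c / t) * y i \<le> (\<Sum>j<n. N $$ (i,j) * y j)" if i: "i < n" for i
  proof -
    have "(\<Sum>j<n. N $$ (i,j) * y j) = (\<Sum>j<n. M $$ (i,j) * y j) / t"
      unfolding sum_divide_distrib by (rule sum.cong) (use i M in \<open>auto simp: N_def\<close>)
    thus ?thesis using sub[OF i] t0 by (simp add: divide_right_mono)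
  qed
  have q: "c / t > 1" using t t0 by simp
  have bound: "(c / t) ^ k * y p \<le> b * (\<Sum>j<n. y j)" for k
  proof -
    have "(c / t) ^ k * y p \<le> (\<Sum>j<n. (N ^\<^sub>m k) $$ (p,j) * y j)"
      using subinvariant_power[OF N Nnn _ Nsub] q p(1) by auto
    also have "\<dots> \<le> (\<Sum>j<n. b * y j)"
    proof (rule sum_mono, rule mult_right_mono)
      fix j assume j: "j \<in> {..<n}"
      have "?B ^\<^sub>m k = map_mat complex_of_real (N ^\<^sub>m k)"
        by (rule of_real_hom.mat_hom_pow[OF N, symmetric])
      hence "norm (map_mat complex_of_real (N ^\<^sub>m k) $$ (p,j)) \<le> b"
        using b[of k] j p N unfolding norm_bound_def by auto
      thus "(N ^\<^sub>m k) $$ (p,j) \<le> b" using j p N by auto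
    qed (use y in auto)
    finally show ?thesis by (simp add: sum_distrib_left)
  qed
  obtain k where "b * (\<Sum>j<n. y j) / y p < (c / t) ^ k" using real_arch_pow[OF q] by blast
  thus False using bound[of k] p(2) by (simp add: field_simps)
qed

text \<open>Collatz-Wielandt comparison: at an index \<open>p\<close> maximising
  \<open>y j / x j\<close>, \<open>y\<close> equals \<open>Max S * x\<close>, and nowhere does it
  exceed that multiple. Row \<open>p\<close> alone therefore bounds the modulus of the eigenvalue by
  \<open>c\<close>.\<close>

lemma spectral_radius_le_superinvariant:
  fixes M :: "real mat" and x :: "nat \<Rightarrow> real"
  assumes M: "M \<in> carrier_mat n n" and n: "n > 0"
    and nonneg: "\<And>i j. i < n \<Longrightarrow> j < n \<Longrightarrow> M $$ (i,j) \<ge> 0"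
    and x: "\<And>i. i < n \<Longrightarrow> x i > 0"
    and super: "\<And>i. i < n \<Longrightarrow> (\<Sum>j<n. M $$ (i,j) * x j) \<le> c * x i"
  shows "spectral_radius (map_mat complex_of_real M) \<le> c"
proof -
  let ?C = "map_mat complex_of_real M"
  have C: "?C \<in> carrier_mat n n" using M by simp
  obtain \<mu> where \<mu>: "eigenvalue ?C \<mu>" "spectral_radius ?C = cmod \<mu>"
    using spectral_radius_mem_max(1)[OF C n] by (auto simp: spectrum_def)
  obtain y :: "nat \<Rightarrow> real" where y: "\<And>i. y i \<ge> 0" "\<exists>i<n. y i > 0"
    "\<And>i. i < n \<Longrightarrow> cmod \<mu> * y i \<le> (\<Sum>j<n. M $$ (i,j) * y j)"
    using eigenvalue_modulus_subinvariant[OF M nonneg \<mu>(1)] by blast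
  define S where "S = (\<lambda>i. y i / x i) ` {..<n}"
  have S: "finite S" "S \<noteq> {}" using n by (auto simp: S_def)
  obtain p where p: "p < n" "Max S = y p / x p" using Max_in[OF S] by (auto simp: S_def)
  have max: "y j \<le> Max S * x j" if "j < n" for j
  proof -
    have "y j / x j \<le> Max S" using that S by (auto simp: S_def)
    thus ?thesis using x[OF that] by (simp add: field_simps)
  qed
  \<comment> \<open>Since \<open>y\<close> does not vanish identically, the multiplier is positive
    and can be cancelled at the end.\<close>
  have Spos: "Max S > 0"
  proof -
    obtain i where i: "i < n" "y i > 0" using y(2) by blast
    hence "0 < Max S * x i" using max[OF i(1)] by simp
    thus ?thesis using x[OF i(1)] by (simp add: zero_less_mult_iff)
  qed
  have "cmod \<mu> * (Max S * x p) = cmod \<mu> * y p" using p x[OF p(1)] by simp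
  also have "\<dots> \<le> (\<Sum>j<n. M $$ (p,j) * y j)" using y(3) p by simp
  also have "\<dots> \<le> (\<Sum>j<n. M $$ (p,j) * (Max S * x j))"
    by (intro sum_mono mult_left_mono max nonneg) (use p in auto)
  also have "\<dots> = Max S * (\<Sum>j<n. M $$ (p,j) * x j)"
    by (simp add: sum_distrib_left mult.left_commute)
  also have "\<dots> \<le> Max S * (c * x p)" using Spos super[OF p(1)] by simp
  finally have "cmod \<mu> * (Max S * x p) \<le> c * (Max S * x p)" by (simp add: ac_simps)
  moreover have "Max S * x p > 0" using Spos x[OF p(1)] by simp
  ultimately show ?thesis using \<mu>(2) mult_le_cancel_right_pos by metis
qed

section \<open>Perron-Frobenius theory for irreducible matrices with positive diagonal\<close>

text \<open>
  If the subinvariant vector \<open>y\<close> coming from an eigenvector of maximal modulus were not itself an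
  eigenvector, the nonzero defect \<open>\<delta> = M y - \<rho> y\<close> would become strictly positive after applying \<open>M\<close>
  often enough, so that an iterate of \<open>y\<close> would be subinvariant for some factor larger than \<open>\<rho>\<close>.
\<close>

lemma spectral_radius_in_spectrum:
  fixes M :: "real mat"
  assumes M: "M \<in> carrier_mat n n" and n: "n > 0"
    and nonneg: "\<And>i j. i < n \<Longrightarrow> j < n \<Longrightarrow> M $$ (i,j) \<ge> 0"
    and diag: "\<And>i. i < n \<Longrightarrow> M $$ (i,i) > 0"
    and irred: "\<And>i j. i < n \<Longrightarrow> j < n \<Longrightarrow> (i, j) \<in> {(i, j). i < n \<and> j < n \<and> M $$ (i,j) > 0}\<^sup>*"
  shows "complex_of_real (spectral_radius (map_mat complex_of_real M))
    \<in> spectrum (map_mat complex_of_real M)"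
proof -
  let ?C = "map_mat complex_of_real M"
  have C: "?C \<in> carrier_mat n n" using M by simp
  define \<rho> where "\<rho> = spectral_radius ?C"
  obtain \<mu> where \<mu>: "eigenvalue ?C \<mu>" "\<rho> = cmod \<mu>"
    using spectral_radius_mem_max(1)[OF C n] by (auto simp: spectrum_def \<rho>_def)
  obtain y :: "nat \<Rightarrow> real" where y: "\<And>i. y i \<ge> 0" "\<exists>i<n. y i > 0"
    "\<And>i. i < n \<Longrightarrow> \<rho> * y i \<le> (\<Sum>j<n. M $$ (i,j) * y j)"
    using eigenvalue_modulus_subinvariant[OF M nonneg \<mu>(1)] \<mu>(2) by blast
  define F where "F u i = (\<Sum>j<n. M $$ (i,j) * u j)" for u :: "nat \<Rightarrow> real" and i
  define \<delta> where "\<delta> = (\<lambda>i. F y i - \<rho> * y i)"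
  have F_nonneg: "\<forall>i<n. (F ^^ k) u i \<ge> 0" if "\<forall>i<n. u i \<ge> 0" for u k
    using that by (induction k) (auto simp: F_def intro!: sum_nonneg mult_nonneg_nonneg nonneg)
  have \<delta>0: "\<forall>i<n. \<delta> i \<ge> 0" using y(3) by (auto simp: \<delta>_def F_def)
  have "\<delta> i = 0" if i: "i < n" for i
  proof (rule ccontr)
    assume "\<delta> i \<noteq> 0"
    hence \<delta>i: "\<delta> i > 0" using \<delta>0 i by force
    \<comment> \<open>One application of \<open>F\<close> carries positivity from \<open>q\<close>
      back to every \<open>p\<close> with a positive entry at \<open>(p,q)\<close>.\<close>
    have spread: "(F ^^ Suc k) \<delta> p > 0" if "p < n" "q < n" "M $$ (p,q) > 0" "(F ^^ k) \<delta> q > 0" for p q k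
    proof -
      have "0 < M $$ (p,q) * (F ^^ k) \<delta> q" using that by simp
      also have "\<dots> \<le> (\<Sum>j<n. M $$ (p,j) * (F ^^ k) \<delta> j)"
        by (rule member_le_sum) (use that nonneg F_nonneg[OF \<delta>0] in auto)
      finally show ?thesis by (simp add: F_def)
    qed
    \<comment> \<open>The positive diagonal preserves positivity under further iterations, so paths
      of different lengths can share one exponent \<open>L\<close>.\<close>
    have stay: "(F ^^ (k + l)) \<delta> p > 0" if "p < n" "(F ^^ k) \<delta> p > 0" for p k l
    proof (induction l)
      case (Suc l)
      show ?case using spread[OF that(1) that(1) diag[OF that(1)] Suc] by simp
    qed (use that in simp)
    have "\<exists>k. (F ^^ k) \<delta> p > 0" if "p < n" for p
      using irred[OF that i]
    proof (induction rule: converse_rtrancl_induct)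
      case base
      show ?case by (rule exI[of _ 0]) (use \<delta>i in simp)
    next
      case (step p q)
      then obtain k where "(F ^^ k) \<delta> q > 0" by blast
      hence "(F ^^ Suc k) \<delta> p > 0" using step(1) spread by blast
      thus ?case by blast
    qed
    then obtain K where K: "\<And>p. p < n \<Longrightarrow> (F ^^ K p) \<delta> p > 0" by metis
    define L where "L = Max (K ` {..<n})"
    have pos: "(F ^^ L) \<delta> p > 0" if p: "p < n" for p
    proof -
      have "K p \<le> L" using p by (auto simp: L_def)
      thus ?thesis using stay[OF p K[OF p], of "L - K p"] by simp
    qed
    define w where "w = (F ^^ L) y"
    have w0: "\<forall>p<n. w p \<ge> 0" unfolding w_def by (rule F_nonneg) (use y in auto)
    \<comment> \<open>By linearity of \<open>F\<close>, the defect of an iterate of \<open>y\<close>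
      is the same iterate of the defect \<delta>.\<close>
    have Fw: "\<forall>p<n. F ((F ^^ k) y) p = \<rho> * (F ^^ k) y p + (F ^^ k) \<delta> p" for k
    proof (induction k)
      case 0
      show ?case by (simp add: \<delta>_def)
    next
      case (Suc k)
      have "F (F ((F ^^ k) y)) p = \<rho> * F ((F ^^ k) y) p + F ((F ^^ k) \<delta>) p" for p
      proof -
        have "F (F ((F ^^ k) y)) p = (\<Sum>j<n. M $$ (p,j) * (\<rho> * (F ^^ k) y j + (F ^^ k) \<delta> j))"
          unfolding F_def[of "F ((F ^^ k) y)"] by (rule sum.cong) (use Suc in auto)
        thus ?thesis
          by (simp add: F_def[of "(F ^^ k) y"] F_def[of "(F ^^ k) \<delta>"] algebra_simps sum.distrib sum_distrib_left)
      qed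
      thus ?case by simp
    qed
    \<comment> \<open>The summand 1 in the denominator guards against \<open>w p = 0\<close>; the
      quotient is still small enough for \<open>e * w p\<close> to stay below the defect.\<close>
    define e where "e = Min ((\<lambda>p. (F ^^ L) \<delta> p / (w p + 1)) ` {..<n})"
    have "e \<in> (\<lambda>p. (F ^^ L) \<delta> p / (w p + 1)) ` {..<n}"
      unfolding e_def by (rule Min_in) (use n in auto)
    then obtain p0 where p0: "p0 < n" "e = (F ^^ L) \<delta> p0 / (w p0 + 1)" by auto
    have e: "e > 0" using p0 pos[OF p0(1)] w0 by (auto intro!: divide_pos_pos add_nonneg_pos)
    have sub: "(\<rho> + e) * w p \<le> (\<Sum>j<n. M $$ (p,j) * w j)" if p: "p < n" for p
    proof -
      have "e \<le> (F ^^ L) \<delta> p / (w p + 1)" unfolding e_def by (rule Min_le) (use p in auto)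
      moreover have "w p + 1 > 0" using w0 p by (simp add: add_nonneg_pos)
      ultimately have "e * w p + e \<le> (F ^^ L) \<delta> p" by (simp add: field_simps)
      hence "(\<rho> + e) * w p \<le> F w p" using e Fw[of L] p by (simp add: w_def algebra_simps)
      thus ?thesis by (simp add: F_def)
    qed
    \<comment> \<open>A vanishing \<open>w\<close> would make \<open>F w i\<close> zero, against the
      positive defect at \<open>i\<close>.\<close>
    have "\<exists>p<n. w p > 0"
    proof (rule ccontr)
      assume "\<not> ?thesis"
      hence z: "\<forall>p<n. w p = 0" using w0 by force
      hence "F w i = 0" by (auto simp: F_def)
      thus False using Fw[of L] pos[OF i] z i by (simp add: w_def)
    qed
    then obtain p where p: "p < n" "w p > 0" by blast
    have "\<rho> + e \<le> \<rho>" unfolding \<rho>_def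
      by (rule spectral_radius_ge_subinvariant[OF M nonneg, of _ p]) (use sub w0 p in \<open>auto simp: \<rho>_def\<close>)
    thus False using e by simp
  qed
  hence eq: "(\<Sum>j<n. M $$ (i,j) * y j) = \<rho> * y i" if "i < n" for i
    using that by (simp add: \<delta>_def F_def)
  have "(\<Sum>j<n. ?C $$ (i,j) * complex_of_real (y j)) = complex_of_real \<rho> * complex_of_real (y i)"
    if i: "i < n" for i
  proof -
    have "(\<Sum>j<n. ?C $$ (i,j) * complex_of_real (y j)) = complex_of_real (\<Sum>j<n. M $$ (i,j) * y j)"
      unfolding of_real_sum by (rule sum.cong) (use i M in auto)
    thus ?thesis using eq[OF i] by simp
  qed
  moreover have "\<exists>i<n. complex_of_real (y i) \<noteq> 0" using y(2) by force
  ultimately have "eigenvalue ?C (complex_of_real \<rho>)" unfolding eigenvalue_iff_sum[OF C]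
    by (intro exI[of _ "\<lambda>i. complex_of_real (y i)"]) blast
  thus ?thesis by (simp add: spectrum_def \<rho>_def)
qed

text \<open>
  Moving the smallest diagonal entry \<open>a\<close> out of \<open>M\<close> turns an eigenvalue \<open>- \<rho>\<close> into \<open>- \<rho> - a\<close>, of
  modulus \<open>\<rho> + a\<close>; adding \<open>a\<close> back then yields a vector that is subinvariant for \<open>\<rho> + 2 a\<close>.
\<close>

lemma neg_spectral_radius_not_in_spectrum:
  fixes M :: "real mat"
  assumes M: "M \<in> carrier_mat n n" and n: "n > 0"
    and nonneg: "\<And>i j. i < n \<Longrightarrow> j < n \<Longrightarrow> M $$ (i,j) \<ge> 0"
    and diag: "\<And>i. i < n \<Longrightarrow> M $$ (i,i) > 0"
  shows "- complex_of_real (spectral_radius (map_mat complex_of_real M))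
    \<notin> spectrum (map_mat complex_of_real M)"
proof
  let ?C = "map_mat complex_of_real M"
  have C: "?C \<in> carrier_mat n n" using M by simp
  define \<rho> where "\<rho> = spectral_radius ?C"
  have \<rho>0: "\<rho> \<ge> 0" using spectral_radius_mem_max(1)[OF C n] by (auto simp: \<rho>_def)
  assume "- complex_of_real (spectral_radius ?C) \<in> spectrum ?C"
  hence "eigenvalue ?C (- complex_of_real \<rho>)" by (simp add: spectrum_def \<rho>_def)
  then obtain z where z: "\<exists>i<n. z i \<noteq> 0"
    "\<And>i. i < n \<Longrightarrow> (\<Sum>j<n. ?C $$ (i,j) * z j) = - complex_of_real \<rho> * z i"
    unfolding eigenvalue_iff_sum[OF C] by blast
  define a where "a = Min ((\<lambda>i. M $$ (i,i)) ` {..<n})"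
  have "a \<in> (\<lambda>i. M $$ (i,i)) ` {..<n}" unfolding a_def by (rule Min_in) (use n in auto)
  hence a0: "a > 0" using diag by auto
  have a_le: "a \<le> M $$ (i,i)" if "i < n" for i unfolding a_def by (rule Min_le) (use that in auto)
  define N where "N = mat n n (\<lambda>(i,j). M $$ (i,j) - (if j = i then a else 0))"
  have N: "N \<in> carrier_mat n n" and NC: "map_mat complex_of_real N \<in> carrier_mat n n"
    by (auto simp: N_def)
  have Nnn: "N $$ (i,j) \<ge> 0" if "i < n" "j < n" for i j
    using that nonneg[OF that] a_le by (auto simp: N_def)
  have "(\<Sum>j<n. map_mat complex_of_real N $$ (i,j) * z j) = - complex_of_real (\<rho> + a) * z i"
    if i: "i < n" for i
  proof -
    have "(\<Sum>j<n. map_mat complex_of_real N $$ (i,j) * z j)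
      = (\<Sum>j<n. ?C $$ (i,j) * z j - (if j = i then a * z j else 0))"
      by (rule sum.cong) (use i M in \<open>auto simp: N_def algebra_simps\<close>)
    also have "\<dots> = (\<Sum>j<n. ?C $$ (i,j) * z j) - a * z i"
      using i by (simp add: sum_subtractf)
    finally show ?thesis using z(2)[OF i] by (simp add: algebra_simps)
  qed
  hence "eigenvalue (map_mat complex_of_real N) (- complex_of_real (\<rho> + a))"
    unfolding eigenvalue_iff_sum[OF NC] using z(1) by blast
  from eigenvalue_modulus_subinvariant[OF N Nnn this]
  obtain y :: "nat \<Rightarrow> real" where y: "\<And>i. y i \<ge> 0" "\<exists>i<n. y i > 0"
    "\<And>i. i < n \<Longrightarrow> cmod (- complex_of_real (\<rho> + a)) * y i \<le> (\<Sum>j<n. N $$ (i,j) * y j)"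
    by blast
  have "cmod (- complex_of_real (\<rho> + a)) = \<rho> + a" using \<rho>0 a0 
    by (metis abs_of_nonneg add_nonneg_nonneg less_imp_le norm_minus_cancel norm_of_real)
  note y3 = y(3)[unfolded this]
  have sub: "(\<rho> + 2 * a) * y i \<le> (\<Sum>j<n. M $$ (i,j) * y j)" if i: "i < n" for i
  proof -
    have "(\<Sum>j<n. N $$ (i,j) * y j) = (\<Sum>j<n. M $$ (i,j) * y j - (if j = i then a * y j else 0))"
      by (rule sum.cong) (use i in \<open>auto simp: N_def algebra_simps\<close>)
    also have "\<dots> = (\<Sum>j<n. M $$ (i,j) * y j) - a * y i"
      using i by (simp add: sum_subtractf)
    finally show ?thesis using y3[OF i] by (simp add: algebra_simps)
  qed
  obtain p where p: "p < n" "y p > 0" using y(2) by blast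
  have "\<rho> + 2 * a \<le> \<rho>" unfolding \<rho>_def
    by (rule spectral_radius_ge_subinvariant[OF M nonneg, of _ p]) (use sub y p in \<open>auto simp: \<rho>_def\<close>)
  thus False using a0 by simp
qed

text \<open>This makes the definite description in \<open>lambda_alpha\<close> denote. The spectral
  radius qualifies, being itself an eigenvalue; any real competitor has the same modulus, which
  leaves only its negative, and that is not an eigenvalue.\<close>

lemma the_max_modulus_eigenvalue:
  fixes M :: "real mat"
  assumes M: "M \<in> carrier_mat n n" and n: "n > 0"
    and nonneg: "\<And>i j. i < n \<Longrightarrow> j < n \<Longrightarrow> M $$ (i,j) \<ge> 0"
    and diag: "\<And>i. i < n \<Longrightarrow> M $$ (i,i) > 0"
    and irred: "\<And>i j. i < n \<Longrightarrow> j < n \<Longrightarrow> (i, j) \<in> {(i, j). i < n \<and> j < n \<and> M $$ (i,j) > 0}\<^sup>*"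
  shows "(THE r. complex_of_real r \<in> spectrum (map_mat complex_of_real M) \<and>
     (\<forall>\<mu> \<in> spectrum (map_mat complex_of_real M). cmod \<mu> \<le> cmod (complex_of_real r)))
    = spectral_radius (map_mat complex_of_real M)"
proof (rule the_equality)
  let ?C = "map_mat complex_of_real M"
  have C: "?C \<in> carrier_mat n n" using M by simp
  have \<rho>0: "spectral_radius ?C \<ge> 0" using spectral_radius_mem_max(1)[OF C n] by auto
  have mem: "complex_of_real (spectral_radius ?C) \<in> spectrum ?C"
    by (rule spectral_radius_in_spectrum[OF M n nonneg diag irred])
  show "complex_of_real (spectral_radius ?C) \<in> spectrum ?C \<and>
     (\<forall>\<mu> \<in> spectrum ?C. cmod \<mu> \<le> cmod (complex_of_real (spectral_radius ?C)))"
    using mem \<rho>0 spectral_radius_mem_max(2)[OF C n] by auto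
  fix r assume r: "complex_of_real r \<in> spectrum ?C \<and>
     (\<forall>\<mu> \<in> spectrum ?C. cmod \<mu> \<le> cmod (complex_of_real r))"
  have "\<bar>r\<bar> \<le> spectral_radius ?C" using r spectral_radius_mem_max(2)[OF C n, of "\<bar>r\<bar>"] by force
  moreover have "spectral_radius ?C \<le> \<bar>r\<bar>" using r mem \<rho>0 by force
  moreover have "r \<noteq> - spectral_radius ?C"
    using r neg_spectral_radius_not_in_spectrum[OF M n nonneg diag] by auto
  ultimately show "r = spectral_radius ?C" by linarith
qed

section \<open>Outdegree counts\<close>

text \<open>Without multiple arcs the head map is injective on the arcs leaving
  \<open>u\<close>.\<close>

lemma (in digraph) out_degree_eq_card_successors:
  "out_degree G u = card {w. u \<rightarrow>\<^bsub>G\<^esub> w}"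
proof -
  have "{w. u \<rightarrow>\<^bsub>G\<^esub> w} = head G ` out_arcs G u"
    by (auto simp: arcs_ends_conv)
  moreover have "inj_on (head G) (out_arcs G u)"
    by (rule inj_onI) (auto intro!: no_multi_arcs simp: arc_to_ends_def)
  ultimately show ?thesis by (simp add: out_degree_def card_image)
qed

lemma (in fin_digraph) sum_out_degree: "(\<Sum>u\<in>verts G. out_degree G u) = card (arcs G)"
proof -
  have "arcs G = (\<Union>u\<in>verts G. out_arcs G u)" by auto
  moreover have "card (\<Union>u\<in>verts G. out_arcs G u) = (\<Sum>u\<in>verts G. card (out_arcs G u))"
    by (rule card_UN_disjoint) auto
  ultimately show ?thesis by (simp add: out_degree_def)
qed

text \<open>A path from \<open>u\<close> to some other vertex must begin with an arc leaving
  \<open>u\<close>.\<close>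

lemma (in fin_digraph) strongly_connected_out_degree_pos:
  assumes sc: "strongly_connected G" and n: "card (verts G) \<ge> 2" and u: "u \<in> verts G"
  shows "out_degree G u \<ge> 1"
proof -
  have "\<exists>w\<in>verts G. w \<noteq> u"
  proof (rule ccontr)
    assume "\<not> ?thesis"
    hence "verts G = {u}" using u by blast
    thus False using n by simp
  qed
  then obtain w where "w \<in> verts G" "w \<noteq> u" by blast
  hence "u \<rightarrow>\<^sup>*\<^bsub>G\<^esub> w" "u \<noteq> w" using sc u by auto
  then obtain w' where "u \<rightarrow>\<^bsub>G\<^esub> w'"
    by (cases rule: converse_reachable_cases) auto
  hence "out_arcs G u \<noteq> {}" by (auto simp: arcs_ends_conv)
  thus ?thesis unfolding out_degree_def by (simp add: Suc_le_eq card_gt_0_iff finite_out_arcs)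
qed

text \<open>Count arcs by tail: \<open>u\<close> contributes the number of its out-neighbours, these
  contribute the sum in question, and every remaining vertex contributes at least 1. Absence of
  loops keeps \<open>u\<close> out of its own neighbourhood. The additive form avoids truncated
  subtraction.\<close>

lemma (in digraph) sum_out_degree_successors_le:
  assumes pos: "\<And>w. w \<in> verts G \<Longrightarrow> out_degree G w \<ge> 1" and u: "u \<in> verts G"
  shows "(\<Sum>w | u \<rightarrow>\<^bsub>G\<^esub> w. out_degree G w) + card (verts G) \<le> card (arcs G) + 1"
proof -
  let ?N = "{w. u \<rightarrow>\<^bsub>G\<^esub> w}"
  let ?R = "verts G - insert u ?N"
  have N: "?N \<subseteq> verts G" by auto
  have fN: "finite ?N" by (rule finite_subset[OF N]) simp
  have uN: "u \<notin> ?N" by (auto simp: arcs_ends_conv dest: no_loops)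
  have V: "verts G = insert u ?N \<union> ?R" using N u by auto
  have "card (arcs G) = (\<Sum>w\<in>insert u ?N \<union> ?R. out_degree G w)"
    using sum_out_degree V by simp
  also have "\<dots> = (\<Sum>w\<in>insert u ?N. out_degree G w) + (\<Sum>w\<in>?R. out_degree G w)"
    by (rule sum.union_disjoint) (use fN in auto)
  also have "\<dots> = card ?N + (\<Sum>w\<in>?N. out_degree G w) + (\<Sum>w\<in>?R. out_degree G w)"
    using fN uN by (simp add: out_degree_eq_card_successors[of u])
  finally have "card (arcs G) = card ?N + (\<Sum>w\<in>?N. out_degree G w) + (\<Sum>w\<in>?R. out_degree G w)" .
  moreover have "(\<Sum>w\<in>?R. out_degree G w) \<ge> card ?R"
    using sum_mono[of ?R "\<lambda>_. 1" "out_degree G"] pos by simp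
  moreover have "card (verts G) = card (insert u ?N) + card ?R"
    by (subst V, rule card_Un_disjoint) (use fN in auto)
  moreover have "card (insert u ?N) = card ?N + 1" using fN uN by simp
  ultimately show ?thesis by simp
qed

section \<open>The scalar inequality and the bound for digraphs\<close>

text \<open>Here \<open>T\<close> will be \<open>m - n + 1\<close> and \<open>D\<close> the maximum
  outdegree. The gap between \<open>d = 1\<close> and \<open>d \<ge> 2\<close> reflects integrality;
  the second case needs \<open>d - 2\<close> to be nonnegative.\<close>

lemma average_degree_bound:
  fixes \<alpha> d t T D :: real
  assumes \<alpha>: "1 / 2 \<le> \<alpha>" "\<alpha> < 1" and d: "d = 1 \<or> d \<ge> 2" and dD: "d \<le> D"
    and tD: "t \<le> d * D" and tT: "t \<le> T"
  shows "\<alpha> * d\<^sup>2 + (1 - \<alpha>) * t \<le> (max (\<alpha> * D) ((1 - \<alpha>) * (T / 2)) + 2 * \<alpha>) * d"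
    (is "_ \<le> (?K + _) * _")
  using d
proof
  assume d1: "d = 1"
  have "(1 - \<alpha>) * t \<le> (1 - \<alpha>) * D" using \<alpha> tD d1 by simp
  \<comment> \<open>This is where \<open>1 - \<alpha> \<le> \<alpha>\<close> enters.\<close>
  also have "\<dots> \<le> \<alpha> * D" by (rule mult_right_mono) (use \<alpha> d1 dD in auto)
  finally show ?thesis using d1 \<alpha> by simp
next
  assume d2: "d \<ge> 2"
  have "\<alpha> * d \<le> \<alpha> * D" using \<alpha> dD by simp
  hence K1: "\<alpha> * d \<le> ?K" by simp
  have "(1 - \<alpha>) * t \<le> (1 - \<alpha>) * T" using \<alpha> tT by simp
  hence K2: "(1 - \<alpha>) * t \<le> 2 * ?K" by simp
  \<comment> \<open>Expanded, this reads
    \<open>\<alpha> * d^2 + 2 * ?K \<le> (?K + 2 * \<alpha>) * d\<close>, and \<open>2 * ?K\<close>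
    dominates \<open>(1 - \<alpha>) * t\<close>.\<close>
  have "0 \<le> (?K - \<alpha> * d) * (d - 2)" using K1 d2 by simp
  thus ?thesis using K2 by (simp add: algebra_simps power2_eq_square)
qed

theorem theorem3p1:
  fixes G :: "('a, 'b) pre_digraph" and v :: "nat \<Rightarrow> 'a" and n m :: nat and \<alpha> :: real
  assumes "digraph G" and "strongly_connected G"
    and "n = card (verts G)" and "m = card (arcs G)" and "n \<ge> 4"
    and "bij_betw v {..<n} (verts G)"
    and "1 / 2 \<le> \<alpha>" and "\<alpha> < 1"
  shows "lambda_alpha \<alpha> G v
    \<le> max (\<alpha> * real (max_out_degree G)) ((1 - \<alpha>) * ((real m - real n + 1) / 2)) + 2 * \<alpha>"
proof -
  interpret digraph G by fact
  let ?d = "out_degree G" and ?D = "max_out_degree G" and ?M = "A_alpha_mat \<alpha> G v"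
  have v: "v i \<in> verts G" if "i < n" for i using that assms(6) by (auto simp: bij_betw_def)
  have inj: "inj_on v {..<n}" and img: "v ` {..<n} = verts G" using assms(6) by (auto simp: bij_betw_def)
  have n0: "n > 0" using assms(5) by simp
  have dpos: "?d u \<ge> 1" if "u \<in> verts G" for u
    by (rule strongly_connected_out_degree_pos[OF assms(2) _ that]) (use assms in simp)
  have dD: "?d u \<le> ?D" if "u \<in> verts G" for u
    unfolding max_out_degree_def using that by simp
  have M: "?M \<in> carrier_mat n n"
    by (simp add: A_alpha_mat_def out_degree_mat_def adjacency_mat_def assms(3))
  have entry: "?M $$ (i,j) = (if i = j then \<alpha> * ?d (v i) else 0)
      + (if v i \<rightarrow>\<^bsub>G\<^esub> v j then 1 - \<alpha> else 0)" if "i < n" "j < n" for i j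
    using that by (simp add: A_alpha_mat_def out_degree_mat_def adjacency_mat_def assms(3))
  have nonneg: "?M $$ (i,j) \<ge> 0" if "i < n" "j < n" for i j
    using entry[OF that] assms(7,8) by auto
  have diag: "?M $$ (i,i) > 0" if "i < n" for i
  proof -
    have "\<alpha> * ?d (v i) > 0" using dpos[OF v[OF that]] assms(7) by simp
    thus ?thesis using entry[OF that that] assms(8) by auto
  qed
  let ?E = "{(i, j). i < n \<and> j < n \<and> ?M $$ (i,j) > 0}"
  have edge: "(i, j) \<in> ?E" if "i < n" "j < n" "v i \<rightarrow>\<^bsub>G\<^esub> v j" for i j
    using that entry[OF that(1,2)] assms(7,8) by (auto intro: add_nonneg_pos)
  have irred: "(i, j) \<in> ?E\<^sup>*" if i: "i < n" and j: "j < n" for i j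
  proof -
    \<comment> \<open>Quantifying over the index of the starting vertex lets the induction run along
      the path; injectivity of \<open>v\<close> fixes the index at its end.\<close>
    have "\<forall>i<n. v i = u \<longrightarrow> (i, j) \<in> ?E\<^sup>*" if "u \<rightarrow>\<^sup>*\<^bsub>G\<^esub> v j" for u
      using that
    proof (induction rule: converse_reachable_induct)
      case base
      show ?case using inj j by (auto dest: inj_onD)
    next
      case (step x y)
      have "y \<in> v ` {..<n}" unfolding img using step(1) by (rule adj_in_verts)
      then obtain k where "k < n" "y = v k" by blast
      thus ?case using step edge by (blast intro: converse_rtrancl_into_rtrancl)
    qed
    thus ?thesis using i v[OF i] v[OF j] assms(2) by auto
  qed
  have "lambda_alpha \<alpha> G v = spectral_radius (map_mat complex_of_real ?M)"
    unfolding lambda_alpha_def by (rule the_max_modulus_eigenvalue[OF M n0 nonneg diag irred])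
  also have "\<dots> \<le> max (\<alpha> * real ?D) ((1 - \<alpha>) * ((real m - real n + 1) / 2)) + 2 * \<alpha>"
  proof (rule spectral_radius_le_superinvariant[OF M n0 nonneg, where x = "\<lambda>i. real (?d (v i))"])
    fix i assume i: "i < n"
    show "real (?d (v i)) > 0" using dpos[OF v[OF i]] by simp
    let ?N = "{w. v i \<rightarrow>\<^bsub>G\<^esub> w}"
    have N: "?N \<subseteq> verts G" by auto
    define t where "t = (\<Sum>w\<in>?N. ?d w)"
    have "(\<Sum>j<n. ?M $$ (i,j) * ?d (v j))
      = (\<Sum>j<n. (if j = i then \<alpha> * (real (?d (v j)))\<^sup>2 else 0)
          + (1 - \<alpha>) * (if v j \<in> ?N then real (?d (v j)) else 0))"
      by (rule sum.cong) (use i entry in \<open>auto simp: power2_eq_square algebra_simps\<close>)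
    also have "\<dots> = \<alpha> * (real (?d (v i)))\<^sup>2
        + (1 - \<alpha>) * (\<Sum>j<n. if v j \<in> ?N then real (?d (v j)) else 0)"
      using i by (simp add: sum.distrib sum_distrib_left)
    also have "(\<Sum>j<n. if v j \<in> ?N then real (?d (v j)) else 0)
        = (\<Sum>w\<in>verts G. if w \<in> ?N then real (?d w) else 0)"
      by (rule sum.reindex_bij_betw[OF assms(6)])
    also have "\<dots> = (\<Sum>w\<in>?N. real (?d w))"
      using N by (subst sum.inter_restrict[symmetric]) (auto simp: Int_absorb1)
    also have "\<dots> = real t" by (simp add: t_def)
    also have "\<alpha> * (real (?d (v i)))\<^sup>2 + (1 - \<alpha>) * real t
      \<le> (max (\<alpha> * real ?D) ((1 - \<alpha>) * ((real m - real n + 1) / 2)) + 2 * \<alpha>) * real (?d (v i))"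
    proof (rule average_degree_bound[OF assms(7,8)])
      show "real (?d (v i)) = 1 \<or> real (?d (v i)) \<ge> 2" using dpos[OF v[OF i]] by (auto simp: le_eq_less_or_eq)
      show "real (?d (v i)) \<le> real ?D" using dD[OF v[OF i]] by simp
      have "t \<le> card ?N * ?D" unfolding t_def
        using sum_bounded_above[of ?N ?d ?D] dD N by auto
      thus "real t \<le> real (?d (v i)) * real ?D"
        by (metis of_nat_le_iff of_nat_mult out_degree_eq_card_successors)
      \<comment> \<open>The additive inequality on naturals is rearranged only after casting, so
        nothing is truncated.\<close>
      show "real t \<le> real m - real n + 1"
        using sum_out_degree_successors_le[OF dpos v[OF i], folded t_def] assms(3,4) by simp
    qed
    finally show "(\<Sum>j<n. ?M $$ (i,j) * real (?d (v j)))
      \<le> (max (\<alpha> * real ?D) ((1 - \<alpha>) * ((real m - real n + 1) / 2)) + 2 * \<alpha>) * real (?d (v i))" .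
  qed
  finally show ?thesis .
qed

end
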